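(* Let $a,b,c,d\in\mathbb{Z}$ with $b,d\ge 2$, and assume $\gcd(a,b)=\gcd(c,d)=1$ and $\gcd(a,d)=\gcd(b,d)=1$. Then for every integer $k\ge 1$ there exist coprime integers $S_0,S_1$ and distinct indices $2\le n_1<n_2<\cdots<n_k$ such that the sequence of rational numbers $(S_n)_{n\ge 0}$ with initial terms $S_0,S_1$ defined by $$S_{n+2}=\frac{a}{b}S_{n+1}+\frac{c}{d}S_n\qquad (n\ge 0)$$ satisfies $S_{n_j}\in\mathbb{Z}$ for each $1\le j\le k$. *)

theory Defs
  imports Complex_Main
begin

fun rec_seq :: "rat \<Rightarrow> rat \<Rightarrow> rat \<Rightarrow> rat \<Rightarrow> nat \<Rightarrow> rat" where
  "rec_seq p q s0 s1 0 = s0"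
| "rec_seq p q s0 s1 (Suc 0) = s1"
| "rec_seq p q s0 s1 (Suc (Suc n)) = p * rec_seq p q s0 s1 (Suc n) + q * rec_seq p q s0 s1 n"

end

theory Submission
  imports Defs "HOL-Number_Theory.Cong" "HOL-Combinatorics.Cycles"
begin

text \<open>
  Clear denominators along the even indices: with \<open>E m = b^(2m) d^m S(2m)\<close> and
  \<open>O m = b^(2m+1) d^m S(2m+1)\<close> the pair \<open>(E, O)\<close> evolves by an integral linear map of determinant
  \<open>(b^2 c)^2\<close>, and \<open>S(2m)\<close> is an integer iff \<open>b^(2m)\<close> and \<open>d^m\<close> both divide \<open>E m\<close>.

  Modulo a power of \<open>b\<close>, Hensel's lemma provides an initial vector that is an eigenvector for an
  eigenvalue divisible by \<open>b^4\<close>; this yields the divisibility by \<open>b^(2m)\<close> for all \<open>m\<close> up to any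
  prescribed bound.  Modulo \<open>d^l\<close> the map is invertible, hence has a finite period \<open>r l\<close>.  Take
  \<open>m_1 < \<dots> < m_k\<close> with \<open>r m_i\<close> dividing \<open>m_j - m_i\<close> for \<open>i < j\<close> and run the map backwards from
  \<open>(0, 1)\<close> modulo \<open>d^(m_k)\<close>, so that \<open>E m_k\<close> vanishes modulo \<open>d^(m_k)\<close>; periodicity gives
  \<open>E m_i = 0\<close> modulo \<open>d^(m_i)\<close> for every \<open>i\<close>.  The Chinese remainder theorem combines the two
  conditions, and any common factor of the initial terms is prime to \<open>b d\<close> and can be divided out.
\<close>

section \<open>The two-step map modulo an integer: invertibility and periodicity\<close>

text \<open>The recurrence enters with \<open>q = b^2 * c\<close>; \<open>q\<close> stays a
  parameter because invertibility modulo \<open>D\<close> rests on \<open>q\<close> being prime to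
  \<open>D\<close>.\<close>

definition two_step :: "int \<Rightarrow> int \<Rightarrow> int \<Rightarrow> int \<times> int \<Rightarrow> int \<times> int" where
  "two_step a d q = (\<lambda>(e, f). (a * d * f + q * e, a * (a * d * f + q * e) + q * f))"

definition cong_pair :: "int \<Rightarrow> int \<times> int \<Rightarrow> int \<times> int \<Rightarrow> bool" where
  "cong_pair D x y \<longleftrightarrow> [fst x = fst y] (mod D) \<and> [snd x = snd y] (mod D)"

lemma cong_pair_trans: "cong_pair D x y \<Longrightarrow> cong_pair D y z \<Longrightarrow> cong_pair D x z"
  unfolding cong_pair_def using cong_trans by blast

lemma cong_pair_sym: "cong_pair D x y \<Longrightarrow> cong_pair D y x"
  unfolding cong_pair_def by (simp add: cong_sym_eq)

lemma cong_pair_two_step: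
  assumes "cong_pair D x y"
  shows "cong_pair D (two_step a d q x) (two_step a d q y)"
  using assms unfolding cong_pair_def two_step_def
  by (auto simp: case_prod_unfold intro!: cong_add cong_mult)

lemma cong_pair_funpow:
  assumes "cong_pair D x y"
  shows "cong_pair D ((two_step a d q ^^ m) x) ((two_step a d q ^^ m) y)"
  using assms by (induction m) (auto intro: cong_pair_two_step)

text \<open>Subtracting \<open>a\<close> times the first coordinate from the second leaves
  \<open>q * f\<close>; once \<open>f\<close> is known, the first leaves \<open>q * e\<close>. Both
  times the unit \<open>q\<close> cancels.\<close>

lemma two_step_cancel:
  assumes "coprime q D" "cong_pair D (two_step a d q x) (two_step a d q y)"
  shows "cong_pair D x y"
proof -
  obtain e f e' f' where [simp]: "x = (e, f)" "y = (e', f')"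
    by (cases x, cases y)
  have 1: "[a * d * f + q * e = a * d * f' + q * e'] (mod D)"
    and 2: "[a * (a * d * f + q * e) + q * f = a * (a * d * f' + q * e') + q * f'] (mod D)"
    using assms(2) by (auto simp: cong_pair_def two_step_def)
  have "[a * (a * d * f + q * e) = a * (a * d * f' + q * e')] (mod D)"
    using 1 by (rule cong_scalar_left)
  from cong_diff[OF 2 this] have f: "[f = f'] (mod D)"
    using assms(1) by (simp add: cong_mult_lcancel)
  hence "[a * d * f = a * d * f'] (mod D)"
    by (rule cong_scalar_left)
  from cong_diff[OF 1 this] have "[e = e'] (mod D)"
    using assms(1) by (simp add: cong_mult_lcancel)
  with f show ?thesis by (simp add: cong_pair_def)
qed

text \<open>Being injective modulo \<open>D\<close>, the map permutes the finite set of residue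
  pairs, and such a permutation has finite order.\<close>

lemma two_step_periodic:
  assumes "D > 0" "coprime q D"
  shows "\<exists>r>0. \<forall>x. cong_pair D ((two_step a d q ^^ r) x) x"
proof -
  define B where "B = {0..<D} \<times> {0..<D}"
  define red where "red = (\<lambda>x::int \<times> int. (fst x mod D, snd x mod D))"
  \<comment> \<open>Extended by the identity outside \<open>B\<close>, as \<open>permutes\<close>
    demands.\<close>
  define p where "p = (\<lambda>x. if x \<in> B then red (two_step a d q x) else x)"
  have red_B: "red x \<in> B" for x
    using assms(1) by (auto simp: red_def B_def)
  have red_cong: "cong_pair D (red x) x" for x
    by (simp add: red_def cong_pair_def)
  have red_eq: "red x = red y \<longleftrightarrow> cong_pair D x y" for x y
    by (auto simp: red_def cong_pair_def cong_def)
  have red_id: "red x = x" if "x \<in> B" for x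
    using that by (auto simp: red_def B_def)
  have fin: "finite B" by (simp add: B_def)
  have "inj_on p B"
  proof
    fix x y assume "x \<in> B" "y \<in> B" "p x = p y"
    hence "cong_pair D (two_step a d q x) (two_step a d q y)"
      by (simp add: p_def red_eq)
    from two_step_cancel[OF assms(2) this] have "red x = red y" by (simp add: red_eq)
    thus "x = y" using \<open>x \<in> B\<close> \<open>y \<in> B\<close> by (simp add: red_id)
  qed
  moreover have pB: "p ` B \<subseteq> B" by (auto simp: p_def red_B)
  ultimately have "bij_betw p B B"
    using fin by (simp add: bij_betw_def endo_inj_surj)
  hence "p permutes B" by (rule bij_imp_permutes) (simp add: p_def)
  hence "permutation p" using fin by (auto simp: permutation_permutes)
  then obtain r where r: "p ^^ r = id" "r > 0"
    using permutation_is_nilpotent by blast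
  have iter: "(p ^^ m) x \<in> B \<and> cong_pair D ((p ^^ m) x) ((two_step a d q ^^ m) x)"
    if "x \<in> B" for m x
  proof (induction m)
    case 0
    thus ?case using that by (simp add: cong_pair_def)
  next
    case (Suc m)
    have "cong_pair D (p ((p ^^ m) x)) (two_step a d q ((p ^^ m) x))"
      using Suc by (simp add: p_def red_cong)
    with Suc pB show ?case
      by (auto intro: cong_pair_trans cong_pair_two_step)
  qed
  have "cong_pair D ((two_step a d q ^^ r) x) x" for x
  proof -
    have "cong_pair D ((two_step a d q ^^ r) x) ((two_step a d q ^^ r) (red x))"
      by (intro cong_pair_funpow cong_pair_sym[OF red_cong])
    moreover have "cong_pair D ((two_step a d q ^^ r) (red x)) (red x)"
      using iter[OF red_B, of r x] r by (simp add: cong_pair_sym)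
    ultimately show ?thesis using red_cong cong_pair_trans by blast
  qed
  with r show ?thesis by blast
qed

lemma cong_pair_funpow_mult:
  assumes "\<And>x. cong_pair D ((two_step a d q ^^ r) x) x"
  shows "cong_pair D ((two_step a d q ^^ (r * t)) x) x"
proof (induction t)
  case 0
  thus ?case by (simp add: cong_pair_def)
next
  case (Suc t)
  have "cong_pair D ((two_step a d q ^^ r) ((two_step a d q ^^ (r * t)) x))
          ((two_step a d q ^^ (r * t)) x)"
    by (rule assms)
  from cong_pair_trans[OF this Suc] show ?case by (simp add: funpow_add)
qed

section \<open>Homogeneity and the link with the recurrence\<close>

lemma two_step_scale:
  "(two_step a d q ^^ m) (g * e, g * f) =
     (g * fst ((two_step a d q ^^ m) (e, f)), g * snd ((two_step a d q ^^ m) (e, f)))"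
  by (induction m) (auto simp: two_step_def case_prod_unfold algebra_simps)

text \<open>Every step costs a factor \<open>b\<close>, but one \<open>d\<close> per two steps
  suffices, since \<open>d\<close> is only the denominator of the coefficient two places back. Odd
  terms carry one extra \<open>b\<close>, whence the start \<open>b * s1\<close>.\<close>

lemma rec_seq_two_step:
  fixes a b c d s0 s1 :: int
  assumes "b \<noteq> 0" "d \<noteq> 0"
  defines "S \<equiv> rec_seq (of_int a / of_int b) (of_int c / of_int d) (of_int s0) (of_int s1)"
    and "x \<equiv> \<lambda>m. (two_step a d (b^2 * c) ^^ m) (s0, b * s1)"
  shows "of_int (b^(2*m) * d^m) * S (2*m) = of_int (fst (x m)) \<and>
         of_int (b^(2*m+1) * d^m) * S (2*m+1) = of_int (snd (x m))"
proof (induction m)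
  case 0
  thus ?case by (simp add: S_def x_def)
next
  case (Suc m)
  define u v where "u = S (2*m)" and "v = S (2*m+1)"
  have S2: "S (2 * Suc m) = of_int a / of_int b * v + of_int c / of_int d * u"
    by (simp add: S_def u_def v_def)
  have S3: "S (2 * Suc m + 1) = of_int a / of_int b * S (2 * Suc m) + of_int c / of_int d * v"
    by (simp add: S_def v_def)
  have E: "of_int (b^(2*m) * d^m) * u = of_int (fst (x m))"
    and F: "of_int (b^(2*m+1) * d^m) * v = of_int (snd (x m))"
    using Suc by (auto simp: u_def v_def)
  have xS: "x (Suc m) = two_step a d (b^2 * c) (x m)" by (simp add: x_def)
  have 1: "of_int (b^(2*Suc m) * d^Suc m) * S (2 * Suc m) = of_int (fst (x (Suc m)))"
  proof -
    have "of_int (b^(2*Suc m) * d^Suc m) * S (2 * Suc m)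
        = of_int (a * d) * (of_int (b^(2*m+1) * d^m) * v)
          + of_int (b^2 * c) * (of_int (b^(2*m) * d^m) * u)"
      unfolding S2 using assms(1,2) by (simp add: field_simps power2_eq_square)
    thus ?thesis unfolding E F xS by (simp add: two_step_def case_prod_unfold)
  qed
  have "of_int (b^(2*Suc m+1) * d^Suc m) * S (2 * Suc m + 1)
      = of_int a * (of_int (b^(2*Suc m) * d^Suc m) * S (2 * Suc m))
        + of_int (b^2 * c) * (of_int (b^(2*m+1) * d^m) * v)"
    unfolding S3 using assms(1,2) by (simp add: field_simps power2_eq_square)
  hence "of_int (b^(2*Suc m+1) * d^Suc m) * S (2 * Suc m + 1) = of_int (snd (x (Suc m)))"
    unfolding 1 F xS by (simp add: two_step_def case_prod_unfold)
  with 1 show ?case by simp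
qed

section \<open>Divisibility by powers of b\<close>

text \<open>With denominators cleared, the congruence says that \<open>b * y\<close> is a root of
  the characteristic equation \<open>t^2 = (a/b) * t + c/d\<close>.\<close>

lemma quadratic_root_mod_power:
  fixes a b c d :: int
  assumes "b > 0" "coprime a b" "coprime d b"
  shows "\<exists>y. [b^2 * d * y^2 = a * d * y + c] (mod b^K)"
proof -
  define D where "D = b^K"
  have D: "D > 0" using assms(1) by (simp add: D_def)
  define h where "h = (\<lambda>y. (b^2 * d * y^2 - a * d * y) mod D)"
  \<comment> \<open>a difference of values of the quadratic is \<open>y - z\<close> times a unit modulo \<open>b\<close>, so it permutes the residues\<close>
  have "inj_on h {0..<D}"
  proof
    fix y z assume yz: "y \<in> {0..<D}" "z \<in> {0..<D}" "h y = h z"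
    hence "D dvd (b^2 * d * y^2 - a * d * y) - (b^2 * d * z^2 - a * d * z)"
      by (simp add: h_def mod_eq_dvd_iff)
    also have "\<dots> = (y - z) * (d * (b * (b * (y + z)) - a))"
      by (simp add: algebra_simps power2_eq_square)
    finally have dvd: "D dvd (y - z) * (d * (b * (b * (y + z)) - a))" .
    have "coprime b (b * (b * (y + z)) - a)"
      using assms(2) gcd_add_mult[of b "b * (y + z)" "- a"]
      by (simp add: coprime_iff_gcd_eq_1 mult.commute gcd.commute)
    hence "coprime D (d * (b * (b * (y + z)) - a))"
      using assms(3) by (simp add: D_def coprime_commute)
    with dvd have "D dvd y - z" by (simp add: coprime_dvd_mult_left_iff)
    hence "y mod D = z mod D" by (simp add: mod_eq_dvd_iff)
    thus "y = z" using yz by simp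
  qed
  moreover have "h ` {0..<D} \<subseteq> {0..<D}" using D by (auto simp: h_def)
  ultimately have "h ` {0..<D} = {0..<D}" by (simp add: endo_inj_surj)
  moreover have "c mod D \<in> {0..<D}" using D by simp
  ultimately obtain y where "h y = c mod D" by (metis imageE)
  hence "[b^2 * d * y^2 - a * d * y = c] (mod D)" by (simp add: h_def cong_def)
  from cong_add[OF this cong_refl[of "a * d * y"]] show ?thesis
    unfolding D_def by (auto simp: add.commute)
qed

text \<open>Modulo \<open>D\<close> the solution imitates the geometric sequence of ratio
  \<open>b * y\<close>. With the scaling, two steps multiply by \<open>b^2 * d * (b * y)^2\<close>,
  and passing from an even to the next odd term multiplies by \<open>b * (b * y)\<close>.\<close>

lemma two_step_eigenvector:
  fixes a b c d s0 s1 y D :: int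
  assumes y: "[b^2 * d * y^2 = a * d * y + c] (mod D)"
    and s1: "[s1 = b * y * s0] (mod D)"
  defines "x \<equiv> \<lambda>m. (two_step a d (b^2 * c) ^^ m) (s0, b * s1)"
  shows "[fst (x m) = (b^4 * d * y^2)^m * s0] (mod D) \<and>
         [snd (x m) = b^2 * y * fst (x m)] (mod D)"
proof (induction m)
  case 0
  from cong_scalar_left[OF s1, of b] show ?case
    by (simp add: x_def power2_eq_square mult.assoc)
next
  case (Suc m)
  define e f where "e = fst (x m)" and "f = snd (x m)"
  have e: "[e = (b^4 * d * y^2)^m * s0] (mod D)" and f: "[f = b^2 * y * e] (mod D)"
    using Suc by (auto simp: e_def f_def)
  define e' where "e' = a * d * f + b^2 * c * e"
  have xS: "fst (x (Suc m)) = e'" "snd (x (Suc m)) = a * e' + b^2 * c * f"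
    by (simp_all add: x_def two_step_def case_prod_unfold e'_def e_def f_def)
  have "[e' = a * d * (b^2 * y * e) + b^2 * c * e] (mod D)"
    unfolding e'_def by (intro cong_add cong_scalar_left f cong_refl)
  also have "a * d * (b^2 * y * e) + b^2 * c * e = (a * d * y + c) * (b^2 * e)"
    by (simp add: algebra_simps)
  also have "[(a * d * y + c) * (b^2 * e) = b^2 * d * y^2 * (b^2 * e)] (mod D)"
    by (intro cong_scalar_right cong_sym[OF y])
  also have "b^2 * d * y^2 * (b^2 * e) = b^4 * d * y^2 * e"
    by (simp add: algebra_simps flip: power_add)
  finally have e': "[e' = b^4 * d * y^2 * e] (mod D)" .
  have "[a * e' + b^2 * c * f = a * (b^4 * d * y^2 * e) + b^2 * c * (b^2 * y * e)] (mod D)"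
    by (intro cong_add cong_scalar_left f e')
  also have "a * (b^4 * d * y^2 * e) + b^2 * c * (b^2 * y * e) = (a * d * y + c) * (b^4 * y * e)"
    by (simp add: algebra_simps power2_eq_square power4_eq_xxxx)
  also have "[(a * d * y + c) * (b^4 * y * e) = b^2 * d * y^2 * (b^4 * y * e)] (mod D)"
    by (intro cong_scalar_right cong_sym[OF y])
  also have "b^2 * d * y^2 * (b^4 * y * e) = b^2 * y * (b^4 * d * y^2 * e)"
    by (simp add: algebra_simps)
  also have "[b^2 * y * (b^4 * d * y^2 * e) = b^2 * y * e'] (mod D)"
    by (intro cong_scalar_left cong_sym[OF e'])
  finally have 2: "[snd (x (Suc m)) = b^2 * y * fst (x (Suc m))] (mod D)"
    by (simp add: xS)
  have "[e' = b^4 * d * y^2 * ((b^4 * d * y^2)^m * s0)] (mod D)"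
    using e' cong_scalar_left[OF e] by (rule cong_trans)
  with 2 show ?case by (simp add: xS mult.assoc)
qed

section \<open>Divisibility by powers of d\<close>

text \<open>Let each gap be the product of all \<open>r u\<close> with \<open>u \<le> m j\<close>.
  It is a multiple of \<open>r (m i)\<close> for every \<open>i \<le> j\<close>, and so are sums of
  consecutive gaps from \<open>m i\<close> on.\<close>

lemma exists_divisibility_sequence:
  fixes r :: "nat \<Rightarrow> nat"
  assumes "\<And>l. r l > 0"
  shows "\<exists>m :: nat \<Rightarrow> nat. strict_mono m \<and> (\<forall>j. m j \<ge> 1) \<and> (\<forall>i j. i \<le> j \<longrightarrow> r (m i) dvd m j - m i)"
proof -
  define m where "m = rec_nat (1::nat) (\<lambda>_ u. u + (\<Prod>i\<le>u. r i))"
  have m0: "m 0 = 1" and mS: "m (Suc j) = m j + (\<Prod>i\<le>m j. r i)" for j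
    by (simp_all add: m_def)
  have mono: "strict_mono m"
    by (rule strict_mono_Suc_iff[THEN iffD2]) (simp add: mS assms prod_pos)
  have "m j \<ge> 1" for j by (induction j) (simp_all add: m0 mS)
  moreover have "r (m i) dvd m j - m i" if "i \<le> j" for i j
    using that
  proof (induction j rule: dec_induct)
    case base
    thus ?case by simp
  next
    case (step j)
    have le: "m i \<le> m j" using mono step(1) by (simp add: strict_mono_less_eq)
    hence "r (m i) dvd (\<Prod>i\<le>m j. r i)" by (intro dvd_prodI) auto
    with step.IH have "r (m i) dvd (m j - m i) + (\<Prod>i\<le>m j. r i)" by simp
    thus ?case using le by (simp add: mS)
  qed
  ultimately show ?thesis using mono by blast
qed

text \<open>The value 1 of the second coordinate serves to show later that a common factor of the
  initial terms is prime to \<open>d\<close>. Allowing every \<open>x\<close> congruent to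
  \<open>z\<close> leaves room for the condition modulo a power of \<open>b\<close>.\<close>

lemma exists_vanishing_mod_powers:
  fixes a d q :: int
  assumes "d > 0" "coprime q d"
  shows "\<exists>m :: nat \<Rightarrow> nat. strict_mono m \<and> (\<forall>j. m j \<ge> 1) \<and>
    (\<forall>k. \<exists>z. \<forall>x. cong_pair (d ^ m k) x z \<longrightarrow>
       [snd ((two_step a d q ^^ m k) x) = 1] (mod d ^ m k) \<and>
       (\<forall>i\<le>k. d ^ m i dvd fst ((two_step a d q ^^ m i) x)))"
proof -
  let ?T = "two_step a d q"
  have "\<exists>r>0. \<forall>x. cong_pair (d ^ l) ((?T ^^ r) x) x" for l
    using assms by (intro two_step_periodic) auto
  then obtain r where r: "\<And>l. r l > 0" "\<And>l x. cong_pair (d ^ l) ((?T ^^ r l) x) x"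
    by metis
  obtain m :: "nat \<Rightarrow> nat" where m: "strict_mono m" "\<And>j. m j \<ge> 1" "\<And>i j. i \<le> j \<Longrightarrow> r (m i) dvd m j - m i"
    using exists_divisibility_sequence[of r] r(1) by blast
  have "\<exists>z. \<forall>x. cong_pair (d ^ m k) x z \<longrightarrow>
       [snd ((?T ^^ m k) x) = 1] (mod d ^ m k) \<and>
       (\<forall>i\<le>k. d ^ m i dvd fst ((?T ^^ m i) x))" for k
  proof -
    define M where "M = m k"
    \<comment> \<open>As \<open>r M\<close> is a period modulo \<open>d ^ M\<close>, these steps
      undo \<open>M\<close> steps: \<open>z\<close> is the backward image of
      \<open>(0, 1)\<close>.\<close>
    define z where "z = (?T ^^ ((r M - 1) * M)) (0, 1)"
    have "M + (r M - 1) * M = r M * M"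
      using r(1)[of M] by (cases "r M") auto
    hence "(?T ^^ M) z = (?T ^^ (r M * M)) (0, 1)"
      by (simp add: z_def flip: funpow_add[THEN fun_cong, unfolded o_apply])
    hence z: "cong_pair (d ^ M) ((?T ^^ M) z) (0, 1)"
      using cong_pair_funpow_mult[OF r(2)] by simp
    have "[snd ((?T ^^ M) x) = 1] (mod d ^ M) \<and> (\<forall>i\<le>k. d ^ m i dvd fst ((?T ^^ m i) x))"
      if x: "cong_pair (d ^ M) x z" for x
    proof (intro conjI allI impI)
      have x': "cong_pair (d ^ M) ((?T ^^ M) x) (0, 1)"
        using cong_pair_funpow[OF x] z by (rule cong_pair_trans)
      thus "[snd ((?T ^^ M) x) = 1] (mod d ^ M)" by (simp add: cong_pair_def)
      fix i assume "i \<le> k"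
      hence le: "m i \<le> M" using m(1) by (simp add: M_def strict_mono_less_eq)
      obtain t where t: "M - m i = r (m i) * t"
        using m(3)[OF \<open>i \<le> k\<close>] by (auto simp: M_def)
      have "(?T ^^ M) x = (?T ^^ (r (m i) * t)) ((?T ^^ m i) x)"
        using le t by (metis funpow_add o_apply le_add_diff_inverse2)
      hence "cong_pair (d ^ m i) ((?T ^^ M) x) ((?T ^^ m i) x)"
        using cong_pair_funpow_mult[OF r(2)] by simp
      hence "[fst ((?T ^^ m i) x) = fst ((?T ^^ M) x)] (mod d ^ m i)"
        by (simp add: cong_pair_def cong_sym)
      moreover have "[fst ((?T ^^ M) x) = 0] (mod d ^ m i)"
        using x' le by (auto simp: cong_pair_def intro: cong_dvd_modulus le_imp_power_dvd)
      ultimately have "[fst ((?T ^^ m i) x) = 0] (mod d ^ m i)" by (rule cong_trans)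
      thus "d ^ m i dvd fst ((?T ^^ m i) x)" by (simp add: cong_0_iff)
    qed
    thus ?thesis unfolding M_def by blast
  qed
  with m(1,2) show ?thesis by blast
qed

section \<open>Combination of the two conditions\<close>

theorem theorem1p6:
  fixes a b c d :: int and k :: nat
  assumes "b \<ge> 2" and "d \<ge> 2"
    and "gcd a b = 1" and "gcd c d = 1"
    and "gcd a d = 1" and "gcd b d = 1"
    and "k \<ge> 1"
  shows "\<exists>(S0::int) (S1::int) (n::nat \<Rightarrow> nat).
           coprime S0 S1 \<and>
           strict_mono_on {1..k} n \<and>
           (\<forall>j\<in>{1..k}. 2 \<le> n j) \<and>
           (\<forall>j\<in>{1..k}.
              rec_seq (of_int a / of_int b) (of_int c / of_int d) (of_int S0) (of_int S1) (n j) \<in> \<int>)"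
proof -
  let ?T = "two_step a d (b^2 * c)"
  have cop: "coprime a b" "coprime c d" "coprime b d"
    using assms by (simp_all add: coprime_iff_gcd_eq_1)
  have "d > 0" "coprime (b^2 * c) d" using assms(2) cop by simp_all
  then obtain m :: "nat \<Rightarrow> nat" where m: "strict_mono m" "\<And>j. m j \<ge> 1" and
    ex: "\<And>k. \<exists>z. \<forall>x. cong_pair (d ^ m k) x z \<longrightarrow>
       [snd ((?T ^^ m k) x) = 1] (mod d ^ m k) \<and> (\<forall>i\<le>k. d ^ m i dvd fst ((?T ^^ m i) x))"
    using exists_vanishing_mod_powers[of d "b^2 * c" a] by blast
  define M where "M = m k"
  have M: "M \<ge> 1" using m(2) by (simp add: M_def)
  obtain z where z: "\<And>x. cong_pair (d ^ M) x z \<Longrightarrow>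
       [snd ((?T ^^ M) x) = 1] (mod d ^ M)"
      "\<And>x i. cong_pair (d ^ M) x z \<Longrightarrow> i \<le> k \<Longrightarrow> d ^ m i dvd fst ((?T ^^ m i) x)"
    using ex[of k] unfolding M_def by blast
  \<comment> \<open>The exponent \<open>2*M\<close> covers every \<open>2 * m j\<close> with
    \<open>j \<le> k\<close>.\<close>
  obtain y where y: "[b^2 * d * y^2 = a * d * y + c] (mod b ^ (2*M))"
    using quadratic_root_mod_power[of b a d c "2*M"] assms(1) cop
    by (auto simp: coprime_commute)
  \<comment> \<open>The state has second coordinate \<open>b * s1\<close>, so matching
    \<open>snd z\<close> requires dividing by \<open>b\<close>.\<close>
  obtain b' where b': "[b * b' = 1] (mod d ^ M)"
    using cong_solve_coprime_int[of b "d ^ M"] cop by auto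
  have copM: "coprime (b ^ (2*M)) (d ^ M)" using cop by simp
  \<comment> \<open>The residue 1 makes \<open>s0\<close>, hence its gcd with \<open>s1\<close>,
    prime to \<open>b\<close>.\<close>
  obtain s0 where s0: "[s0 = 1] (mod b ^ (2*M))" "[s0 = fst z] (mod d ^ M)"
    using binary_chinese_remainder_int[OF copM] by blast
  obtain s1 where s1: "[s1 = b * y * s0] (mod b ^ (2*M))" "[s1 = b' * snd z] (mod d ^ M)"
    using binary_chinese_remainder_int[OF copM] by blast
  define x where "x = (s0, b * s1)"
  have "[b * s1 = (b * b') * snd z] (mod d ^ M)"
    using cong_scalar_left[OF s1(2), of b] by (simp add: mult.assoc)
  also have "[(b * b') * snd z = 1 * snd z] (mod d ^ M)"
    by (intro cong_scalar_right b')
  finally have xz: "cong_pair (d ^ M) x z"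
    using s0(2) by (simp add: cong_pair_def x_def)

  define g where "g = gcd s0 s1"
  have cop_g_b: "coprime g b"
  proof -
    have "[s0 = 1] (mod b)" using s0(1) M by (auto intro: cong_dvd_modulus)
    hence "coprime s0 b" using cong_imp_coprime[OF cong_sym, of s0 1 b] by simp
    thus ?thesis using coprime_divisors[of g s0 b b] by (simp add: g_def)
  qed
  obtain t0 t1 where t: "s0 = g * t0" "s1 = g * t1"
    unfolding g_def by (meson dvdE gcd_dvd1 gcd_dvd2)
  \<comment> \<open>This makes the gcd nonzero, so that the quotients \<open>t0\<close> and
    \<open>t1\<close> are coprime.\<close>
  have "s0 \<noteq> 0"
  proof
    assume "s0 = 0"
    hence "b ^ (2*M) dvd 1" using s0(1) by (simp add: cong_0_iff cong_sym_eq)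
    moreover have "b dvd b ^ (2*M)" using M by (intro dvd_power) simp
    ultimately have "b dvd 1" by (rule dvd_trans[rotated])
    thus False using assms(1) by simp
  qed
  hence "gcd s0 s1 \<noteq> 0" by simp
  moreover have "s0 = t0 * gcd s0 s1" "s1 = t1 * gcd s0 s1"
    unfolding g_def[symmetric] using t by (metis mult.commute)+
  ultimately have cop_t: "coprime t0 t1" by (rule gcd_coprime)
  define E where "E = (\<lambda>m. (?T ^^ m) (t0, b * t1))"
  have xE: "(?T ^^ m) x = (g * fst (E m), g * snd (E m))" for m
    using two_step_scale[where g = g and e = t0 and f = "b * t1"]
    by (simp add: x_def t E_def mult.left_commute)
  have cop_g_d: "coprime g d"
  proof -
    \<comment> \<open>By homogeneity \<open>g\<close> divides the second coordinate at time
      \<open>M\<close>, which is a unit modulo \<open>d\<close>.\<close>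
    have "[g * snd (E M) = 1] (mod d ^ M)" using z(1)[OF xz] by (simp add: xE)
    hence "[g * snd (E M) = 1] (mod d)" using M by (auto intro: cong_dvd_modulus)
    from cong_imp_coprime[OF cong_sym[OF this]] have "coprime (g * snd (E M)) d" by simp
    thus ?thesis by simp
  qed
  define n where "n = (\<lambda>j. 2 * m j)"
  let ?S = "rec_seq (of_int a / of_int b) (of_int c / of_int d) (of_int t0) (of_int t1)"
  have int: "?S (n j) \<in> \<int>" if "j \<le> k" for j
  proof -
    have le: "m j \<le> M" using m(1) that by (simp add: M_def strict_mono_less_eq)
    have "d ^ m j dvd g * fst (E (m j))" using z(2)[OF xz that] by (simp add: xE)
    hence d: "d ^ m j dvd fst (E (m j))"
      using cop_g_d by (simp add: coprime_dvd_mult_right_iff coprime_commute)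
    have "[g * fst (E (m j)) = (b^4 * d * y^2)^m j * s0] (mod b ^ (2*M))"
      using two_step_eigenvector[OF y s1(1), of "m j"] by (simp add: xE flip: x_def)
    hence "[g * fst (E (m j)) = (b^4 * d * y^2)^m j * s0] (mod b ^ (2*m j))"
      by (rule cong_dvd_modulus) (simp add: le le_imp_power_dvd)
    moreover have "b ^ (2*m j) dvd (b^4 * d * y^2)^m j * s0"
      unfolding power_mult by (intro dvd_mult2 dvd_power_same le_imp_power_dvd) simp
    ultimately have "b ^ (2*m j) dvd g * fst (E (m j))"
      by (metis cong_dvd_iff)
    hence "b ^ (2*m j) dvd fst (E (m j))"
      using cop_g_b by (simp add: coprime_dvd_mult_right_iff coprime_commute)
    with d have "b ^ (2*m j) * d ^ m j dvd fst (E (m j))"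
      using cop(3) by (intro divides_mult) auto
    then obtain w where w: "fst (E (m j)) = b ^ (2*m j) * d ^ m j * w" by (rule dvdE)
    have "of_int (b ^ (2*m j) * d ^ m j) * ?S (n j) = of_int (fst (E (m j)))"
      using rec_seq_two_step[of b d "m j" a c t0 t1] assms(1,2) by (simp add: n_def E_def)
    also have "\<dots> = of_int (b ^ (2*m j) * d ^ m j) * of_int w"
      by (simp add: w)
    finally have "?S (n j) = of_int w"
      using assms(1,2) by simp
    thus ?thesis by simp
  qed
  have "strict_mono_on {1..k} n"
    using m(1) by (auto simp: n_def strict_mono_on_def strict_mono_def)
  moreover have "2 \<le> n j" for j using m(2)[of j] by (simp add: n_def)
  ultimately show ?thesis
    using cop_t int by (intro exI[of _ t0] exI[of _ t1] exI[of _ n]) auto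
qed

end
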